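(* Suppose we choose $\mathcal T$ uniformly at random from $\overline{\mathsf D}\mathsf{Sch}_{n-1}$. As $n\to\infty$, \[\mathbb E(\mathrm{des}(\mathcal P(\mathcal T))+1)\sim\left(1-\frac{1}{2\log 2}\right)n.\]
   Context: A binary plane tree is a finite (possibly empty) rooted tree in which every vertex has at most two children, every child is designated as either a left child or a right child (not both), and no vertex has two left children or two right children. A Schröder $2$-colored binary tree is a binary plane tree in which each vertex is colored black or white in such a way that no white vertex has a left child. $\overline{\mathsf D}\mathsf{Sch}_{m}$ is the set of Schröder $2$-colored binary trees with $m$ vertices whose vertices are bijectively labeled with $1,\dots,m$ so that every nonroot vertex has a smaller label than its parent. The postorder reading $\mathcal P$ is defined recursively: $\mathcal P$ of the empty tree is the empty permutation, and $\mathcal P(\mathcal T)=\mathcal P(\mathcal T_L)\,\mathcal P(\mathcal T_R)\,m$ if $\mathcal T$ has root label $m$ and left and right subtrees $\mathcal T_L,\mathcal T_R$. $\mathrm{des}(\pi)$ is the number of indices $i$ with $\pi_i>\pi_{i+1}$. $\log$ is the natural logarithm. *)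

theory Defs
  imports "HOL-Probability.Probability" "HOL-Library.Tree" "HOL-Library.Landau_Symbols"
begin

text \<open>
  A binary plane tree is a value of the library type \<open>'a tree\<close>: \<open>Leaf\<close> is the empty tree (not a
  vertex) and \<open>Node l x r\<close> is a vertex carrying \<open>x\<close>, with left and right subtrees \<open>l\<close>, \<open>r\<close>. Every
  vertex below carries a pair of a colour and a label; \<open>size\<close> counts the vertices.
\<close>

datatype colour = Black | White

type_synonym coloured_tree = "(colour \<times> nat) tree"

fun schroeder_tree :: "coloured_tree \<Rightarrow> bool" where
  "schroeder_tree Leaf \<longleftrightarrow> True"
| "schroeder_tree (Node l (c, a) r) \<longleftrightarrow>
     (c = White \<longrightarrow> l = Leaf) \<and> schroeder_tree l \<and> schroeder_tree r"

text \<open>\<open>root_label\<close> is only meaningful on nonempty trees.\<close>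

abbreviation root_label :: "coloured_tree \<Rightarrow> nat" where
  "root_label t \<equiv> snd (tree.value t)"

fun decreasing_tree :: "coloured_tree \<Rightarrow> bool" where
  "decreasing_tree Leaf \<longleftrightarrow> True"
| "decreasing_tree (Node l (c, a) r) \<longleftrightarrow>
     (l \<noteq> Leaf \<longrightarrow> root_label l < a) \<and> (r \<noteq> Leaf \<longrightarrow> root_label r < a) \<and>
     decreasing_tree l \<and> decreasing_tree r"

text \<open>
  The postorder reading of labels, as a word. The library function \<open>postorder\<close> satisfies
  \<open>postorder (Node l x r) = postorder l @ postorder r @ [x]\<close>.
\<close>

definition postorder_reading :: "coloured_tree \<Rightarrow> nat list" where
  "postorder_reading t = map snd (postorder t)"

text \<open>
  Every vertex contributes exactly one entry to the postorder reading, so the last two conditions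
  say that the labelling is a bijection from the vertices onto \<open>{1..m}\<close>.
\<close>

definition DSch :: "nat \<Rightarrow> coloured_tree set" where
  "DSch m = {t. schroeder_tree t \<and> decreasing_tree t \<and> size t = m \<and>
                distinct (postorder_reading t) \<and> set (postorder_reading t) = {1..m}}"

definition des :: "nat list \<Rightarrow> nat" where
  "des w = card {i. Suc i < length w \<and> w ! i > w ! Suc i}"

text \<open>
  \<open>DSch m\<close> is finite and nonempty, so \<open>pmf_of_set (DSch m)\<close> is the uniform distribution on it.
\<close>

lemma finite_trees_bounded:
  assumes "finite A"
  shows "finite {t :: 'a tree. size t \<le> m \<and> set_tree t \<subseteq> A}" (is "finite (?S m)")
proof (induction m)
  case 0
  have "?S 0 \<subseteq> {Leaf}" by auto
  then show ?case by (rule finite_subset) simp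
next
  case (Suc m)
  have "?S (Suc m) \<subseteq> insert Leaf ((\<lambda>(l, x, r). Node l x r) ` (?S m \<times> A \<times> ?S m))"
  proof
    fix t assume "t \<in> ?S (Suc m)"
    then show "t \<in> insert Leaf ((\<lambda>(l, x, r). Node l x r) ` (?S m \<times> A \<times> ?S m))"
      by (cases t) (auto simp: image_iff)
  qed
  then show ?case
    by (rule finite_subset) (use Suc assms in auto)
qed

lemma finite_DSch: "finite (DSch m)"
proof -
  have "finite (UNIV :: colour set)"
    by (rule finite_subset[of _ "{Black, White}"]) (auto intro: colour.exhaust)
  then have "finite {t :: coloured_tree. size t \<le> m \<and> set_tree t \<subseteq> UNIV \<times> {1..m}}"
    by (intro finite_trees_bounded) auto
  moreover have "DSch m \<subseteq> {t. size t \<le> m \<and> set_tree t \<subseteq> UNIV \<times> {1..m}}"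
    by (force simp: DSch_def postorder_reading_def)
  ultimately show ?thesis by (rule finite_subset[rotated])
qed

lemma DSch_nonempty: "DSch m \<noteq> {}"
proof -
  have "\<exists>t. t \<in> DSch m"
  proof (induction m)
    case 0
    have "Leaf \<in> DSch 0" by (simp add: DSch_def postorder_reading_def)
    then show ?case by blast
  next
    case (Suc m)
    then obtain t where t: "t \<in> DSch m" by blast
    have "root_label t < Suc m" if "t \<noteq> Leaf"
    proof -
      have "root_label t \<in> set (postorder_reading t)"
        using that by (cases t) (auto simp: postorder_reading_def)
      with t show ?thesis by (auto simp: DSch_def)
    qed
    with t have "Node Leaf (White, Suc m) t \<in> DSch (Suc m)"
      by (auto simp: DSch_def postorder_reading_def atLeastAtMostSuc_conv)
    then show ?case by blast
  qed
  then show ?thesis by blast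
qed

end

theory Submission
  imports Defs "HOL-Complex_Analysis.Complex_Analysis" "HOL-Real_Asymp.Real_Asymp"
begin

text \<open>
  Let \<open>A\<close>, \<open>D\<close> be the exponential generating functions of the number of trees and of the total number
  of descents of their postorder readings. Removing the root, which carries the largest label, gives
  \<open>A' = A + A\<^sup>2\<close> (white root, black root), so \<open>A = exp x / (2 - exp x)\<close>, see \<open>card_labelled_trees\<close>.
  The descents of the reading of a tree are those of its two subtrees, plus possibly one where the two
  readings meet, so \<open>D' = D + 2 A D + (A - 1)\<^sup>2 - H\<close>, where \<open>H\<close> counts the pairs of nonempty trees whose
  readings meet in an ascent.

  In such an ascending pair the largest label is the root of the right tree. Removing it as well
  yields a linear equation for \<open>H\<close> (\<open>ascending_pairs_eq\<close>), solved by
  \<open>H = 2 (exp x - 1)\<^sup>2 / (2 - exp x)\<close>. The inhomogeneity \<open>(A - 1)\<^sup>2 - H\<close> then collapses to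
  \<open>(exp x - 1)\<^sup>2 A'\<close>, and because \<open>A'\<close> solves the homogeneous equation for \<open>D\<close>, the result is
  \<open>D = A' V\<close> with the entire function \<open>V = exp (2 x) / 2 - 2 exp x + x + 3/2\<close>
  (\<open>sum_des_labelled_trees\<close>).

  The dominant singularity of \<open>A\<close> is the simple pole at \<open>ln 2\<close> with principal part \<open>1 / (ln 2 - x)\<close>, so
  the coefficients satisfy \<open>a\<^sub>m \<sim> (ln 2) powr - (m + 1)\<close> (\<open>tree_series_coeff_limit\<close>). Multiplying \<open>A'\<close> by an
  entire function scales the coefficients asymptotically by its value at the singularity
  (\<open>cauchy_product_linear_weight\<close>), here \<open>V (ln 2) = ln 2 - 1/2\<close>. Hence
  \<open>d\<^sub>m \<sim> (ln 2 - 1/2) (m + 1) a\<close> with \<open>a\<close> the coefficient of index \<open>m + 1\<close>, which is asymptotically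
  \<open>a\<^sub>m / ln 2\<close>. The mean number \<open>d\<^sub>m / a\<^sub>m\<close> of descents is therefore asymptotic to
  \<open>(1 - 1 / (2 ln 2)) (m + 1)\<close>.
\<close>

section \<open>Exponential generating functions over subsets of labels\<close>

definition egf :: "real fps \<Rightarrow> nat \<Rightarrow> real" where
  "egf f n = fact n * fps_nth f n"

text \<open>
  Sorting the subsets of \<open>S\<close> by cardinality turns the sum into a binomial convolution. In this form,
  distributing a label set over two subtrees is multiplication of series, for arbitrary sets of
  labels, so that no tree ever has to be relabelled.
\<close>

lemma egf_mult:
  assumes "finite S"
  shows "egf (f * g) (card S) = (\<Sum>L\<in>Pow S. egf f (card L) * egf g (card (S - L)))"
proof -
  let ?n = "card S"
  have "(\<Sum>L\<in>Pow S. egf f (card L) * egf g (card (S - L)))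
      = (\<Sum>L\<in>Pow S. egf f (card L) * egf g (?n - card L))"
    using assms by (intro sum.cong) (auto simp: card_Diff_subset finite_subset)
  also have "\<dots> = (\<Sum>k\<le>?n. \<Sum>L\<in>{L\<in>Pow S. card L = k}. egf f (card L) * egf g (?n - card L))"
    using assms by (intro sum.group[symmetric]) (auto intro: card_mono)
  also have "\<dots> = (\<Sum>k\<le>?n. real (?n choose k) * (egf f k * egf g (?n - k)))"
    using assms by (intro sum.cong) (auto simp: n_subsets)
  also have "\<dots> = (\<Sum>k\<le>?n. fact ?n * (fps_nth f k * fps_nth g (?n - k)))"
    by (intro sum.cong) (auto simp: egf_def binomial_fact)
  also have "\<dots> = egf (f * g) ?n"
    by (simp add: egf_def fps_mult_nth sum_distrib_left atLeast0AtMost)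
  finally show ?thesis ..
qed

lemma egf_Suc: "egf f (Suc n) = egf (fps_deriv f) n"
  by (simp add: egf_def algebra_simps)

lemma egf_add: "egf (f + g) n = egf f n + egf g n"
  and egf_diff: "egf (f - g) n = egf f n - egf g n"
  and egf_one: "egf 1 n = of_bool (n = 0)"
  by (auto simp: egf_def algebra_simps)

text \<open>
  Deleting the root of a decreasing tree deletes its largest label, and what remains is split into
  two arbitrary subsets; hence an induction that removes the maximum and then allows all subsets.
\<close>

lemma finite_max_induct [consumes 1, case_names empty insert]:
  fixes S :: "nat set"
  assumes "finite S" and empty: "P {}"
    and step: "\<And>M S. finite S \<Longrightarrow> \<forall>x\<in>S. x < M \<Longrightarrow> (\<And>U. U \<subseteq> S \<Longrightarrow> P U) \<Longrightarrow> P (insert M S)"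
  shows "P S"
  using \<open>finite S\<close>
proof (induction rule: finite_psubset_induct)
  case (psubset S)
  show ?case
  proof (cases "S = {}")
    case False
    let ?M = "Max S" and ?S = "S - {Max S}"
    have M: "?M \<in> S" using psubset False by simp
    have "P (insert ?M ?S)"
    proof (rule step)
      show "\<forall>x\<in>?S. x < ?M" using psubset by (auto simp: order.strict_iff_order)
      show "P U" if "U \<subseteq> ?S" for U using that M by (intro psubset.IH) blast
    qed (use psubset in simp)
    then show ?thesis using M by (simp add: insert_absorb)
  qed (simp add: empty)
qed

section \<open>Decomposition of decreasing trees at the root\<close>

text \<open>
  Arbitrary label sets are allowed because the subtrees of a tree labelled by \<open>{1..m}\<close> split the
  labels in an arbitrary way.
\<close>

definition labelled_trees :: "nat set \<Rightarrow> coloured_tree set" where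
  "labelled_trees S = {t. schroeder_tree t \<and> decreasing_tree t \<and>
     distinct (postorder_reading t) \<and> set (postorder_reading t) = S}"

lemma postorder_reading_Leaf [simp]: "postorder_reading Leaf = []"
  and postorder_reading_Node [simp]:
    "postorder_reading (Node l (c, a) r) = postorder_reading l @ postorder_reading r @ [a]"
  by (auto simp: postorder_reading_def)

lemma postorder_reading_eq_Nil_iff [simp]: "postorder_reading t = [] \<longleftrightarrow> t = Leaf"
  by (cases t) (auto simp: postorder_reading_def)

lemma DSch_eq_labelled_trees: "DSch m = labelled_trees {1..m}"
proof -
  have "size t = m" if "distinct (postorder_reading t)" "set (postorder_reading t) = {1..m}" for t
    using distinct_card[OF that(1)] that(2) by (simp add: postorder_reading_def)
  then show ?thesis by (auto simp: DSch_def labelled_trees_def)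
qed

lemma label_le_root:
  "decreasing_tree t \<Longrightarrow> x \<in> set (postorder_reading t) \<Longrightarrow> x \<le> root_label t"
proof (induction t)
  case (Node l v r)
  obtain c a where v: "v = (c, a)" by (cases v)
  show ?case
    using Node unfolding v by (cases "l = Leaf"; cases "r = Leaf") force+
qed simp

lemma root_label_in: "t \<noteq> Leaf \<Longrightarrow> root_label t \<in> set (postorder_reading t)"
  by (cases t) (auto simp: postorder_reading_def)

lemma last_postorder_reading:
  "t \<noteq> Leaf \<Longrightarrow> last (postorder_reading t) = root_label t"
  by (cases t) (auto simp: postorder_reading_def)

lemma labelled_trees_empty: "labelled_trees {} = {Leaf}"
  by (auto simp: labelled_trees_def)

lemma Leaf_in_labelled_trees_iff: "Leaf \<in> labelled_trees S \<longleftrightarrow> S = {}"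
  by (auto simp: labelled_trees_def)

lemma labelled_treesD: "t \<in> labelled_trees S \<Longrightarrow> set (postorder_reading t) = S"
  by (simp add: labelled_trees_def)

text \<open>
  The largest label can only sit at the root. A white root carries just a right subtree, and below
  a black root the other labels are split freely between the two sides.
\<close>

lemma labelled_trees_insert:
  assumes "\<forall>x\<in>S. x < M"
  shows "labelled_trees (insert M S) =
     Node Leaf (White, M) ` labelled_trees S \<union>
     (\<Union>L\<in>Pow S. (\<lambda>(l, r). Node l (Black, M) r) ` (labelled_trees L \<times> labelled_trees (S - L)))"
    (is "_ = ?W \<union> ?B")
proof (intro equalityI subsetI)
  fix t assume t: "t \<in> labelled_trees (insert M S)"
  then obtain l c a r where t_eq: "t = Node l (c, a) r"
    by (cases t) (auto simp: labelled_trees_def)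
  have "M \<le> root_label t" using t by (intro label_le_root) (auto simp: labelled_trees_def)
  moreover have "a \<in> insert M S" using t by (auto simp: t_eq labelled_trees_def)
  ultimately have a: "a = M" using assms by (auto simp: t_eq)
  have S: "set (postorder_reading l) \<union> set (postorder_reading r) = S"
    using t assms by (auto simp: t_eq a labelled_trees_def)
  show "t \<in> ?W \<union> ?B"
  proof (cases c)
    case Black
    have "(l, r) \<in> labelled_trees (set (postorder_reading l)) \<times>
            labelled_trees (S - set (postorder_reading l))"
      using t S by (auto simp: t_eq labelled_trees_def)
    moreover have "set (postorder_reading l) \<in> Pow S" using S by auto
    ultimately have "t \<in> ?B" unfolding t_eq a Black by (force intro!: rev_image_eqI)
    then show ?thesis by blast
  next
    case White
    then have "l = Leaf" using t by (auto simp: t_eq labelled_trees_def)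
    moreover from this have "r \<in> labelled_trees S"
      using t S by (auto simp: t_eq labelled_trees_def)
    ultimately show ?thesis by (auto simp: t_eq a White)
  qed
next
  have *: "t \<noteq> Leaf \<Longrightarrow> root_label t < M"
    if "set (postorder_reading t) \<subseteq> S" for t
    using that assms root_label_in[of t] by auto
  fix t assume "t \<in> ?W \<union> ?B"
  then show "t \<in> labelled_trees (insert M S)"
  proof
    assume "t \<in> ?W"
    then show ?thesis using assms * by (auto simp: labelled_trees_def)
  next
    assume "t \<in> ?B"
    then obtain L l r where "L \<subseteq> S" "l \<in> labelled_trees L" "r \<in> labelled_trees (S - L)"
      "t = Node l (Black, M) r" by auto
    then show ?thesis using assms *[of l] *[of r] by (auto simp: labelled_trees_def)
  qed
qed

lemma finite_labelled_trees:
  assumes "finite S"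
  shows "finite (labelled_trees S)"
  using assms
proof (induction rule: finite_max_induct)
  case (insert M S)
  have "finite (labelled_trees L)" "finite (labelled_trees (S - L))" if "L \<subseteq> S" for L
    using that insert by auto
  then show ?case using insert
    by (auto simp: labelled_trees_insert intro!: finite_imageI finite_cartesian_product)
qed (auto simp: labelled_trees_empty)

lemma sum_labelled_trees_insert:
  fixes f :: "coloured_tree \<Rightarrow> real"
  assumes "finite S" "\<forall>x\<in>S. x < M"
  shows "(\<Sum>t\<in>labelled_trees (insert M S). f t) =
     (\<Sum>r\<in>labelled_trees S. f (Node Leaf (White, M) r)) +
     (\<Sum>L\<in>Pow S. \<Sum>l\<in>labelled_trees L. \<Sum>r\<in>labelled_trees (S - L). f (Node l (Black, M) r))"
proof -
  let ?node = "\<lambda>(l, r). Node l (Black, M) r"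
  let ?B = "\<lambda>L. ?node ` (labelled_trees L \<times> labelled_trees (S - L))"
  have fin: "finite (labelled_trees L)" "finite (labelled_trees (S - L))" if "L \<in> Pow S" for L
    using that assms by (auto intro!: finite_labelled_trees dest: finite_subset)
  have "(\<Sum>t\<in>labelled_trees (insert M S). f t) =
      sum f (Node Leaf (White, M) ` labelled_trees S) + sum f (\<Union>L\<in>Pow S. ?B L)"
    unfolding labelled_trees_insert[OF assms(2)] using assms fin
    by (intro sum.union_disjoint) (auto intro!: finite_imageI finite_labelled_trees)
  also have "sum f (Node Leaf (White, M) ` labelled_trees S) =
      (\<Sum>r\<in>labelled_trees S. f (Node Leaf (White, M) r))"
    by (subst sum.reindex) (auto simp: inj_on_def)
  also have "sum f (\<Union>L\<in>Pow S. ?B L) = (\<Sum>L\<in>Pow S. sum f (?B L))"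
    using assms fin by (intro sum.UNION_disjoint) (auto dest!: labelled_treesD)
  also have "\<dots> = (\<Sum>L\<in>Pow S. \<Sum>l\<in>labelled_trees L. \<Sum>r\<in>labelled_trees (S - L).
      f (Node l (Black, M) r))"
    by (intro sum.cong refl trans[OF sum.reindex])
      (auto simp: inj_on_def sum.cartesian_product case_prod_unfold)
  finally show ?thesis .
qed

section \<open>The generating functions and their differential equations\<close>

text \<open>
  With \<open>E = exp x\<close>: \<open>tree_series\<close> is \<open>E / (2 - E)\<close>, the solution of \<open>A' = A + A\<^sup>2\<close> with
  \<open>A(0) = 1\<close>; \<open>ascent_series\<close> is \<open>2 (E - 1)\<^sup>2 / (2 - E)\<close>. The equations for ascents and
  for descents are linear of first order, and variation of constants solves both: \<open>A'\<close> solves the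
  homogeneous equation \<open>y' = (1 + 2 A) y\<close> for the descents, and the remaining factor
  \<open>descent_factor\<close> is the primitive of \<open>(E - 1)\<^sup>2\<close> that vanishes at \<open>0\<close>.
\<close>

definition tree_series :: "real fps" where
  "tree_series = fps_exp 1 * inverse (2 - fps_exp 1)"

definition ascent_series :: "real fps" where
  "ascent_series = 2 * (fps_exp 1 - 1)^2 * inverse (2 - fps_exp 1)"

definition descent_factor :: "real fps" where
  "descent_factor = fps_const (1/2) * (fps_exp 1)^2 - 2 * fps_exp 1 + fps_X + fps_const (3/2)"

definition descent_series :: "real fps" where
  "descent_series = fps_deriv tree_series * descent_factor"

lemma tree_series_nth_0: "fps_nth tree_series 0 = 1"
  and ascent_series_nth_0: "fps_nth ascent_series 0 = 0"
  and descent_series_nth_0: "fps_nth descent_series 0 = 0"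
  by (simp_all add: tree_series_def ascent_series_def descent_series_def descent_factor_def
      power2_eq_square)

lemma kernel_inverse: "inverse (2 - fps_exp (1::real)) * (2 - fps_exp 1) = 1"
  by (rule inverse_mult_eq_1) simp

lemma deriv_kernel:
  "fps_deriv (inverse (2 - fps_exp (1::real))) = fps_exp 1 * inverse (2 - fps_exp 1) ^ 2"
  by (subst fps_inverse_deriv) simp_all

text \<open>
  The summands of the differential equations are arranged as the recursive decompositions of the
  combinatorial objects produce them.
\<close>

lemma tree_series_ode: "fps_deriv tree_series = tree_series + tree_series * tree_series"
  unfolding tree_series_def by (simp add: deriv_kernel power2_eq_square algebra_simps)

lemma ascent_series_ode:
  "fps_deriv ascent_series = (tree_series - 1 + ascent_series) +
     (ascent_series * tree_series + (tree_series - 1 + ascent_series))"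
proof -
  define E where "E = fps_exp (1::real)"
  define B where "B = inverse (2 - E)"
  have BE: "B * E = 2 * B - 1" using kernel_inverse unfolding B_def E_def by algebra
  have dE: "fps_deriv E = E" by (simp add: E_def)
  have dB: "fps_deriv B = E * B^2" using deriv_kernel by (simp add: E_def B_def)
  have "fps_deriv ascent_series = 4 * (E - 1) * E * B + 2 * (E - 1)^2 * (E * B^2)"
    unfolding ascent_series_def E_def[symmetric] B_def[symmetric]
    by (simp add: dE dB power2_eq_square algebra_simps)
  then show ?thesis
    unfolding tree_series_def ascent_series_def E_def[symmetric] B_def[symmetric] using BE by algebra
qed

lemma descent_series_ode:
  "fps_deriv descent_series = descent_series +
     (descent_series * tree_series + tree_series * descent_series +
      ((tree_series - 1) * (tree_series - 1) - ascent_series))"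
proof -
  define E where "E = fps_exp (1::real)"
  define B where "B = inverse (2 - E)"
  have BE: "B * E = 2 * B - 1" using kernel_inverse unfolding B_def E_def by algebra
  have dE: "fps_deriv E = E" by (simp add: E_def)
  have "fps_deriv descent_factor = fps_const (1/2) * (2 * E^2) - 2 * E + 1"
    unfolding descent_factor_def E_def[symmetric] by (simp add: dE power2_eq_square algebra_simps)
  also have "fps_const (1/2::real) * (2 * E^2) = E^2"
    by (simp add: fps_eq_iff numeral_fps_const)
  finally have dV: "fps_deriv descent_factor = (E - 1)^2" by (simp add: power2_eq_square algebra_simps)
  let ?A = tree_series and ?J = "(tree_series - 1) * (tree_series - 1) - ascent_series"
  have A_eq: "?A = E * B" by (simp add: tree_series_def E_def B_def)
  \<comment> \<open>the inhomogeneity is a multiple of the derivative of \<open>tree_series\<close>\<close>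
  have "(E - 1)^2 * (?A + ?A * ?A) = ?J"
    unfolding A_eq ascent_series_def E_def[symmetric] B_def[symmetric] using BE by algebra
  then have *: "(?A + ?A * ?A) * fps_deriv descent_factor = ?J"
    by (simp add: dV mult.commute)
  have "fps_deriv descent_series =
      fps_deriv (?A + ?A * ?A) * descent_factor + (?A + ?A * ?A) * fps_deriv descent_factor"
    unfolding descent_series_def tree_series_ode by (simp add: algebra_simps)
  also have "\<dots> = descent_series + (descent_series * ?A + ?A * descent_series + ?J)"
    unfolding * descent_series_def by (simp add: tree_series_ode algebra_simps)
  finally show ?thesis .
qed

section \<open>Counting trees\<close>

lemma card_labelled_trees:
  assumes "finite S"
  shows "real (card (labelled_trees S)) = egf tree_series (card S)"
  using assms
proof (induction rule: finite_max_induct)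
  case (insert M S)
  have M: "M \<notin> S" using insert by auto
  have "real (card (labelled_trees (insert M S))) = (\<Sum>t\<in>labelled_trees (insert M S). 1)"
    by simp
  also have "\<dots> = real (card (labelled_trees S)) + (\<Sum>L\<in>Pow S.
      real (card (labelled_trees L)) * real (card (labelled_trees (S - L))))"
    by (subst sum_labelled_trees_insert) (use insert in auto)
  also have "\<dots> = egf tree_series (card S) + (\<Sum>L\<in>Pow S.
      egf tree_series (card L) * egf tree_series (card (S - L)))"
    using insert by (auto intro!: arg_cong2[of _ _ _ _ "(+)"] sum.cong)
  also have "\<dots> = egf tree_series (card (insert M S))"
    using insert M by (simp add: egf_Suc tree_series_ode egf_add egf_mult)
  finally show ?case .
qed (auto simp: labelled_trees_empty egf_def tree_series_nth_0)

section \<open>Descents at the junction of two words\<close>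

definition junction_ascent :: "nat list \<Rightarrow> nat list \<Rightarrow> real" where
  "junction_ascent u v = of_bool (u \<noteq> [] \<and> v \<noteq> [] \<and> last u < hd v)"

definition junction_descent :: "nat list \<Rightarrow> nat list \<Rightarrow> real" where
  "junction_descent u v = of_bool (u \<noteq> [] \<and> v \<noteq> [] \<and> last u > hd v)"

lemma des_Nil: "des [] = 0"
  by (simp add: des_def)

lemma des_append:
  "real (des (u @ v)) = real (des u) + real (des v) + junction_descent u v"
proof -
  let ?I = "\<lambda>w. {i. Suc i < length w \<and> w ! i > w ! Suc i}"
  let ?J = "if u \<noteq> [] \<and> v \<noteq> [] \<and> last u > hd v then {length u - 1} else {}"
  have "?I (u @ v) = ?I u \<union> (+) (length u) ` ?I v \<union> ?J" (is "?l = ?r")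
  proof (intro equalityI subsetI)
    fix i assume i: "i \<in> ?l"
    consider "Suc i < length u" | "Suc i = length u" | "i \<ge> length u" by linarith
    then show "i \<in> ?r"
    proof cases
      case 1
      then show ?thesis using i by (auto simp: nth_append)
    next
      case 2
      then have "u \<noteq> []" "v \<noteq> []" "i = length u - 1" using i by auto
      then show ?thesis using i 2 by (auto simp: nth_append last_conv_nth hd_conv_nth)
    next
      case 3
      then obtain j where "i = length u + j" using le_Suc_ex by blast
      then show ?thesis using i by (auto simp: nth_append)
    qed
  next
    fix i assume "i \<in> ?r"
    then show "i \<in> ?l"
      by (auto simp: nth_append last_conv_nth hd_conv_nth split: if_splits)
  qed
  moreover have "card ?r = card (?I u) + card (?I v) + card ?J"
  proof -
    have fin: "finite (?I w)" for w :: "nat list"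
      by (rule finite_subset[of _ "{..<length w}"]) auto
    have "card ((+) (length u) ` ?I v) = card (?I v)"
      by (rule card_image) simp
    then show ?thesis
      using fin by (subst card_Un_disjoint; (subst card_Un_disjoint)?)
        (auto simp: neq_Nil_conv)
  qed
  ultimately show ?thesis
    by (simp add: des_def junction_descent_def split: if_splits)
qed

text \<open>
  The root is the largest and the last letter of the reading, so it never ends a descent; new
  descents only arise where the reading of the left subtree meets that of the right one.
\<close>

lemma des_snoc_max:
  assumes "\<forall>x\<in>set u. x < M"
  shows "des (u @ [M]) = des u"
proof -
  have "junction_descent u [M] = 0"
    using assms last_in_set[of u] by (fastforce simp: junction_descent_def)
  moreover have "des [M] = 0" by (simp add: des_def)
  ultimately have "real (des (u @ [M])) = real (des u)" by (simp add: des_append)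
  then show ?thesis by simp
qed

section \<open>Pairs of trees whose readings meet in an ascent\<close>

text \<open>
  Ascents are counted instead of descents because an ascent forces the largest label into the right
  tree: otherwise it would be the last letter of the left reading.
\<close>

definition ascending_pairs :: "nat set \<Rightarrow> real" where
  "ascending_pairs S = (\<Sum>L\<in>Pow S. \<Sum>l\<in>labelled_trees L. \<Sum>r\<in>labelled_trees (S - L).
     junction_ascent (postorder_reading l) (postorder_reading r))"

lemma sum_Leaf_labelled_trees:
  "(\<Sum>t\<in>labelled_trees S. of_bool (t = Leaf) * f t) = of_bool (S = {}) * (f Leaf :: real)"
proof (cases "S = {}")
  case False
  then have "Leaf \<notin> labelled_trees S" by (simp add: Leaf_in_labelled_trees_iff)
  then have "(\<Sum>t\<in>labelled_trees S. of_bool (t = Leaf) * f t) = 0"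
    by (intro sum.neutral) auto
  with False show ?thesis by simp
qed (simp add: labelled_trees_empty)

lemma sum_nonempty_labelled_trees:
  assumes "finite S"
  shows "(\<Sum>t\<in>labelled_trees S. of_bool (t \<noteq> Leaf)) = egf (tree_series - 1) (card S)"
proof -
  have "(\<Sum>t\<in>labelled_trees S. of_bool (t \<noteq> Leaf)) =
      (\<Sum>t\<in>labelled_trees S. 1 - of_bool (t = Leaf) * (1::real))"
    by (intro sum.cong) auto
  also have "\<dots> = real (card (labelled_trees S)) - of_bool (S = {})"
    using assms by (simp only: sum_subtractf sum_Leaf_labelled_trees) simp
  finally show ?thesis
    using assms by (simp add: card_labelled_trees egf_diff egf_one)
qed

lemma sum_Pow_insert_eq:
  assumes "\<And>L. L \<subseteq> insert M S \<Longrightarrow> M \<in> L \<Longrightarrow> f L = (0::real)" and "finite S"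
  shows "sum f (Pow (insert M S)) = sum f (Pow S)"
  by (rule sum.mono_neutral_right) (use assms in auto)

lemma sum_Pow_Pow_diff:
  fixes f :: "'a set \<Rightarrow> 'a set \<Rightarrow> real"
  assumes "finite S"
  shows "(\<Sum>L\<in>Pow S. \<Sum>R\<in>Pow (S - L). f L R) = (\<Sum>U\<in>Pow S. \<Sum>L\<in>Pow U. f L (U - L))"
proof -
  have "(\<Sum>L\<in>Pow S. \<Sum>R\<in>Pow (S - L). f L R) =
      (\<Sum>(L, R)\<in>(SIGMA L:Pow S. Pow (S - L)). f L R)"
    using assms by (subst sum.Sigma) (auto intro: finite_subset)
  also have "\<dots> = (\<Sum>(U, L)\<in>(SIGMA U:Pow S. Pow U). f L (U - L))"
    by (rule sum.reindex_bij_witness[where i = "\<lambda>(U, L). (L, U - L)" and j = "\<lambda>(L, R). (L \<union> R, L)"])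
      (auto intro!: arg_cong2[of _ _ _ _ f])
  also have "\<dots> = (\<Sum>U\<in>Pow S. \<Sum>L\<in>Pow U. f L (U - L))"
    using assms by (subst sum.Sigma) (auto intro: finite_subset)
  finally show ?thesis .
qed

text \<open>
  Treats the first letter of an empty word as infinite. This is the condition that remains on
  \<open>v\<close> when a letter larger than all of \<open>u\<close> is appended to it.
\<close>

definition weak_junction_ascent :: "nat list \<Rightarrow> nat list \<Rightarrow> real" where
  "weak_junction_ascent u v = of_bool (u \<noteq> [] \<and> (v = [] \<or> last u < hd v))"

text \<open>
  Compared with \<open>junction_ascent\<close>, the weak condition also admits every nonempty left tree
  together with an empty right tree, which accounts for the additional \<open>tree_series - 1\<close>.
\<close>

lemma sum_weak_junction_ascent:
  assumes "finite S"
    and "ascending_pairs S = egf ascent_series (card S)"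
  shows "(\<Sum>L\<in>Pow S. \<Sum>l\<in>labelled_trees L. \<Sum>r\<in>labelled_trees (S - L).
      weak_junction_ascent (postorder_reading l) (postorder_reading r)) =
    egf (tree_series - 1 + ascent_series) (card S)"
proof -
  have weak: "weak_junction_ascent (postorder_reading l) (postorder_reading r) =
      junction_ascent (postorder_reading l) (postorder_reading r) +
      of_bool (r = Leaf) * of_bool (l \<noteq> Leaf)" for l r
    by (auto simp: weak_junction_ascent_def junction_ascent_def)
  have "(\<Sum>L\<in>Pow S. \<Sum>l\<in>labelled_trees L. \<Sum>r\<in>labelled_trees (S - L).
        of_bool (r = Leaf) * of_bool (l \<noteq> Leaf)) =
      (\<Sum>L\<in>Pow S. of_bool (S - L = {}) * egf (tree_series - 1) (card L))"
  proof (intro sum.cong refl)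
    fix L assume "L \<in> Pow S"
    then have fin: "finite L" using assms by (auto dest: finite_subset)
    show "(\<Sum>l\<in>labelled_trees L. \<Sum>r\<in>labelled_trees (S - L).
        of_bool (r = Leaf) * of_bool (l \<noteq> Leaf)) =
        of_bool (S - L = {}) * egf (tree_series - 1) (card L)"
      unfolding sum_Leaf_labelled_trees sum_distrib_left[symmetric]
        sum_nonempty_labelled_trees[OF fin] ..
  qed
  also have "\<dots> = (\<Sum>L\<in>{S}. of_bool (S - L = {}) * egf (tree_series - 1) (card L))"
    by (rule sum.mono_neutral_right) (use assms in auto)
  finally have "(\<Sum>L\<in>Pow S. \<Sum>l\<in>labelled_trees L. \<Sum>r\<in>labelled_trees (S - L).
        of_bool (r = Leaf) * of_bool (l \<noteq> Leaf)) = egf (tree_series - 1) (card S)"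
    by simp
  then show ?thesis
    using assms(2) unfolding weak ascending_pairs_def by (simp add: sum.distrib egf_add)
qed

text \<open>
  The first letter of the reading of a tree is that of its left subtree if there is one, else that of
  its right subtree, else the root. The two equal sums on the right belong to a white root and to a
  black root with empty left subtree; in the middle sum the right subtree of a black root is free.
\<close>

lemma sum_junction_ascent_node:
  assumes S: "finite S" "\<forall>x\<in>S. x < M" and u: "\<forall>x\<in>set u. x < M"
  shows "(\<Sum>r\<in>labelled_trees (insert M S). junction_ascent u (postorder_reading r)) =
    (\<Sum>r\<in>labelled_trees S. weak_junction_ascent u (postorder_reading r)) +
    ((\<Sum>R\<in>Pow S. (\<Sum>r\<in>labelled_trees R. junction_ascent u (postorder_reading r)) *
        real (card (labelled_trees (S - R)))) +
     (\<Sum>r\<in>labelled_trees S. weak_junction_ascent u (postorder_reading r)))"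
proof -
  let ?rd = postorder_reading
  have snoc: "junction_ascent u (v @ [M]) = weak_junction_ascent u v" for v
    using u last_in_set[of u]
    by (cases v) (auto simp: junction_ascent_def weak_junction_ascent_def)
  have split: "junction_ascent u (?rd r1 @ ?rd r2 @ [M]) = junction_ascent u (?rd r1) +
      of_bool (r1 = Leaf) * weak_junction_ascent u (?rd r2)" for r1 r2
    using snoc[of "?rd r2"] by (auto simp: junction_ascent_def)
  have "(\<Sum>R\<in>Pow S. \<Sum>r1\<in>labelled_trees R. \<Sum>r2\<in>labelled_trees (S - R).
        of_bool (r1 = Leaf) * weak_junction_ascent u (?rd r2)) =
      (\<Sum>R\<in>Pow S. of_bool (R = {}) * (\<Sum>r2\<in>labelled_trees (S - R). weak_junction_ascent u (?rd r2)))"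
    unfolding sum_distrib_left[symmetric]
    by (intro sum.cong refl sum_Leaf_labelled_trees)
  also have "\<dots> = (\<Sum>R\<in>{{}}. of_bool (R = {}) *
      (\<Sum>r2\<in>labelled_trees (S - R). weak_junction_ascent u (?rd r2)))"
    by (rule sum.mono_neutral_right) (use S in auto)
  also have "\<dots> = (\<Sum>r\<in>labelled_trees S. weak_junction_ascent u (?rd r))"
    by simp
  finally have leaf: "(\<Sum>R\<in>Pow S. \<Sum>r1\<in>labelled_trees R. \<Sum>r2\<in>labelled_trees (S - R).
        of_bool (r1 = Leaf) * weak_junction_ascent u (?rd r2)) =
      (\<Sum>r\<in>labelled_trees S. weak_junction_ascent u (?rd r))" .
  show ?thesis
    unfolding sum_labelled_trees_insert[OF S]
    by (simp add: snoc split sum.distrib leaf sum_distrib_right mult.commute[of "real (card _)"])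
qed

text \<open>
  Peeling off the root \<open>M\<close> of the right tree leaves a left tree together with two subtrees. When the
  left of these supplies the first letter, it forms an ascending pair with the left tree on some
  label set \<open>U\<close>, and the other one is an arbitrary tree on the complement of \<open>U\<close>; regrouping the sum
  by \<open>U\<close> gives the product of \<open>ascent_series\<close> and \<open>tree_series\<close>.
\<close>

lemma ascending_pairs_eq:
  assumes "finite S"
  shows "ascending_pairs S = egf ascent_series (card S)"
  using assms
proof (induction rule: finite_max_induct)
  case (insert M S)
  note S = insert(1,2)
  let ?rd = postorder_reading
  have M: "M \<notin> S" using S by auto
  have IH: "ascending_pairs U = egf ascent_series (card U)" if "U \<subseteq> S" for U
    using insert(3) that by blast
  let ?h = "\<lambda>L T. \<Sum>l\<in>labelled_trees L. \<Sum>r\<in>labelled_trees T. junction_ascent (?rd l) (?rd r)"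
  let ?k = "\<lambda>L T. \<Sum>l\<in>labelled_trees L. \<Sum>r\<in>labelled_trees T. weak_junction_ascent (?rd l) (?rd r)"
  have "ascending_pairs (insert M S) = (\<Sum>L\<in>Pow S. ?h L (insert M S - L))"
    unfolding ascending_pairs_def
  proof (rule sum_Pow_insert_eq)
    fix L assume L: "L \<subseteq> insert M S" "M \<in> L"
    show "?h L (insert M S - L) = 0"
    proof (intro sum.neutral ballI)
      fix l r assume l: "l \<in> labelled_trees L" and r: "r \<in> labelled_trees (insert M S - L)"
      have "M \<le> root_label l" "l \<noteq> Leaf"
        using l L by (auto intro!: label_le_root simp: labelled_trees_def)
      then have "last (?rd l) \<ge> M" by (simp add: last_postorder_reading)
      moreover have "hd (?rd r) \<in> S" if "r \<noteq> Leaf"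
      proof -
        have "hd (?rd r) \<in> set (?rd r)" using that by (intro hd_in_set) simp
        then show ?thesis using r L labelled_treesD[OF r] by auto
      qed
      ultimately show "junction_ascent (?rd l) (?rd r) = 0"
        using S by (fastforce simp: junction_ascent_def)
    qed
  qed (use S in simp)
  also have "\<dots> = (\<Sum>L\<in>Pow S. ?k L (S - L) +
      ((\<Sum>R\<in>Pow (S - L). ?h L R * real (card (labelled_trees (S - L - R)))) + ?k L (S - L)))"
  proof (intro sum.cong refl)
    fix L assume L: "L \<in> Pow S"
    have "?h L (insert M S - L) = (\<Sum>l\<in>labelled_trees L. \<Sum>r\<in>labelled_trees (insert M (S - L)).
        junction_ascent (?rd l) (?rd r))"
      using L M by (subst insert_Diff_if) auto
    also have "\<dots> = (\<Sum>l\<in>labelled_trees L.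
      (\<Sum>r\<in>labelled_trees (S - L). weak_junction_ascent (?rd l) (?rd r)) +
      ((\<Sum>R\<in>Pow (S - L). (\<Sum>r\<in>labelled_trees R. junction_ascent (?rd l) (?rd r)) *
          real (card (labelled_trees (S - L - R)))) +
       (\<Sum>r\<in>labelled_trees (S - L). weak_junction_ascent (?rd l) (?rd r))))"
      using S L by (intro sum.cong refl sum_junction_ascent_node) (auto dest: labelled_treesD)
    also have "\<dots> = ?k L (S - L) +
      ((\<Sum>R\<in>Pow (S - L). ?h L R * real (card (labelled_trees (S - L - R)))) + ?k L (S - L))"
      by (simp add: sum.distrib sum_distrib_right sum_distrib_left sum.swap[of _ "Pow (S - L)"])
    finally show "?h L (insert M S - L) = \<dots>" .
  qed
  also have "\<dots> = (\<Sum>L\<in>Pow S. ?k L (S - L)) +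
      ((\<Sum>L\<in>Pow S. \<Sum>R\<in>Pow (S - L). ?h L R * real (card (labelled_trees (S - L - R)))) +
       (\<Sum>L\<in>Pow S. ?k L (S - L)))"
    by (simp add: sum.distrib sum_distrib_left)
  also have "(\<Sum>L\<in>Pow S. \<Sum>R\<in>Pow (S - L). ?h L R * real (card (labelled_trees (S - L - R)))) =
      (\<Sum>U\<in>Pow S. \<Sum>L\<in>Pow U. ?h L (U - L) * real (card (labelled_trees (S - L - (U - L)))))"
    using S by (intro sum_Pow_Pow_diff)
  also have "\<dots> = (\<Sum>U\<in>Pow S. ascending_pairs U * real (card (labelled_trees (S - U))))"
  proof (intro sum.cong refl)
    fix U assume "U \<in> Pow S"
    have "S - L - (U - L) = S - U" if "L \<in> Pow U" for L using that by auto
    then show "(\<Sum>L\<in>Pow U. ?h L (U - L) * real (card (labelled_trees (S - L - (U - L))))) =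
        ascending_pairs U * real (card (labelled_trees (S - U)))"
      by (simp add: ascending_pairs_def sum_distrib_right)
  qed
  also have "\<dots> = egf (ascent_series * tree_series) (card S)"
    using S IH by (simp add: egf_mult card_labelled_trees)
  also have "(\<Sum>L\<in>Pow S. ?k L (S - L)) = egf (tree_series - 1 + ascent_series) (card S)"
    using S IH by (intro sum_weak_junction_ascent) auto
  also have "egf (tree_series - 1 + ascent_series) (card S) +
      (egf (ascent_series * tree_series) (card S) +
       egf (tree_series - 1 + ascent_series) (card S)) = egf ascent_series (card (insert M S))"
    unfolding card_insert_disjoint[OF S(1) M] egf_Suc ascent_series_ode by (simp only: egf_add)
  finally show ?case .
qed (simp add: ascending_pairs_def labelled_trees_empty junction_ascent_def egf_def ascent_series_nth_0)

section \<open>Counting descents\<close>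

text \<open>
  Labels are distinct, so two nonempty readings that do not meet in an ascent meet in a descent.
\<close>

lemma sum_junction_descent:
  assumes "finite S"
  shows "(\<Sum>L\<in>Pow S. \<Sum>l\<in>labelled_trees L. \<Sum>r\<in>labelled_trees (S - L).
      junction_descent (postorder_reading l) (postorder_reading r)) =
    egf ((tree_series - 1) * (tree_series - 1) - ascent_series) (card S)"
proof -
  let ?rd = postorder_reading
  have "(\<Sum>L\<in>Pow S. \<Sum>l\<in>labelled_trees L. \<Sum>r\<in>labelled_trees (S - L).
      junction_descent (?rd l) (?rd r)) =
    (\<Sum>L\<in>Pow S. \<Sum>l\<in>labelled_trees L. \<Sum>r\<in>labelled_trees (S - L).
      of_bool (l \<noteq> Leaf) * of_bool (r \<noteq> Leaf) - junction_ascent (?rd l) (?rd r))"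
  proof (intro sum.cong refl)
    fix L l r assume L: "L \<in> Pow S" "l \<in> labelled_trees L" "r \<in> labelled_trees (S - L)"
    have "last (?rd l) \<noteq> hd (?rd r)" if "l \<noteq> Leaf" "r \<noteq> Leaf"
    proof -
      have "last (?rd l) \<in> L" "hd (?rd r) \<in> S - L"
        using L that labelled_treesD last_in_set[of "?rd l"] hd_in_set[of "?rd r"] by force+
      then show ?thesis by auto
    qed
    then show "junction_descent (?rd l) (?rd r) =
        of_bool (l \<noteq> Leaf) * of_bool (r \<noteq> Leaf) - junction_ascent (?rd l) (?rd r)"
      by (cases "l = Leaf"; cases "r = Leaf") (auto simp: junction_descent_def junction_ascent_def)
  qed
  also have "\<dots> = (\<Sum>L\<in>Pow S. (\<Sum>l\<in>labelled_trees L. of_bool (l \<noteq> Leaf)) *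
      (\<Sum>r\<in>labelled_trees (S - L). of_bool (r \<noteq> Leaf))) - ascending_pairs S"
    unfolding ascending_pairs_def sum_product by (simp only: sum_subtractf)
  also have "\<dots> = (\<Sum>L\<in>Pow S. egf (tree_series - 1) (card L) *
      egf (tree_series - 1) (card (S - L))) - egf ascent_series (card S)"
    using assms by (auto simp: ascending_pairs_eq dest: finite_subset
        intro!: sum.cong arg_cong2[of _ _ _ _ "(*)"] sum_nonempty_labelled_trees)
  finally show ?thesis using assms by (simp add: egf_mult egf_diff)
qed

lemma sum_des_labelled_trees:
  assumes "finite S"
  shows "(\<Sum>t\<in>labelled_trees S. real (des (postorder_reading t))) = egf descent_series (card S)"
  using assms
proof (induction rule: finite_max_induct)
  case (insert M S)
  note S = insert(1,2)
  let ?rd = postorder_reading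
  have M: "M \<notin> S" using S by auto
  let ?d = "\<lambda>S. \<Sum>t\<in>labelled_trees S. real (des (?rd t))"
  have IH: "?d U = egf descent_series (card U)" if "U \<subseteq> S" for U
    using insert(3) that by blast
  have node: "real (des (?rd l @ ?rd r @ [M])) =
      real (des (?rd l)) + real (des (?rd r)) + junction_descent (?rd l) (?rd r)"
    if "L \<in> Pow S" "l \<in> labelled_trees L" "r \<in> labelled_trees (S - L)" for L l r
  proof -
    have "des ((?rd l @ ?rd r) @ [M]) = des (?rd l @ ?rd r)"
      using S that by (intro des_snoc_max) (auto dest: labelled_treesD)
    then show ?thesis by (simp add: des_append)
  qed
  have "?d (insert M S) = ?d S + (\<Sum>L\<in>Pow S. \<Sum>l\<in>labelled_trees L. \<Sum>r\<in>labelled_trees (S - L).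
      real (des (?rd l)) + real (des (?rd r)) + junction_descent (?rd l) (?rd r))"
    unfolding sum_labelled_trees_insert[OF S]
    using S node by (auto intro!: arg_cong2[of _ _ _ _ "(+)"] sum.cong des_snoc_max dest: labelled_treesD)
  also have "\<dots> = ?d S + ((\<Sum>L\<in>Pow S. ?d L * real (card (labelled_trees (S - L)))) +
      (\<Sum>L\<in>Pow S. real (card (labelled_trees L)) * ?d (S - L)) +
      (\<Sum>L\<in>Pow S. \<Sum>l\<in>labelled_trees L. \<Sum>r\<in>labelled_trees (S - L).
        junction_descent (?rd l) (?rd r)))"
    by (simp add: sum.distrib sum_distrib_left sum_distrib_right mult.commute)
  also have "(\<Sum>L\<in>Pow S. ?d L * real (card (labelled_trees (S - L)))) =
      egf (descent_series * tree_series) (card S)"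
    using S by (simp add: egf_mult card_labelled_trees IH)
  also have "(\<Sum>L\<in>Pow S. real (card (labelled_trees L)) * ?d (S - L)) =
      egf (tree_series * descent_series) (card S)"
    unfolding egf_mult[OF S(1)] using S
    by (intro sum.cong refl) (auto simp: card_labelled_trees IH dest: finite_subset)
  also have "?d S = egf descent_series (card S)" by (rule IH) simp
  also note sum_junction_descent[OF S(1)]
  finally show ?case
    unfolding card_insert_disjoint[OF S(1) M] egf_Suc descent_series_ode by (simp only: egf_add)
qed (simp add: labelled_trees_empty des_Nil egf_def descent_series_nth_0)

section \<open>Growth of the number of trees\<close>

text \<open>
  The other solutions of \<open>exp z = 2\<close> are \<open>ln 2 + 2 \<pi> i k\<close> and have modulus at least \<open>2 \<pi> > 6\<close>. Any
  radius strictly between \<open>ln 2\<close> and the modulus of \<open>ln 2 + 2 \<pi> i\<close> would serve.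
\<close>

lemma exp_eq_two_imp:
  assumes "exp z = (2::complex)" "norm z < 6"
  shows "z = of_real (ln 2)"
proof (rule exp_complex_eqI)
  have "\<bar>Im z\<bar> < 6" using abs_Im_le_cmod[of z] assms by linarith
  then show "\<bar>Im z - Im (of_real (ln 2))\<bar> < 2 * pi" using pi_gt3 by simp
  have "exp (complex_of_real (ln 2)) = of_real (exp (ln 2))" by (rule exp_of_real)
  then show "exp z = exp (of_real (ln 2))" using assms by simp
qed

text \<open>
  The factor \<open>ln 2 - z\<close> cancels the simple pole of \<open>exp z / (2 - exp z)\<close> at \<open>ln 2\<close>, the only one in
  the disc of radius 6. The Taylor series of the product at \<open>0\<close> therefore still converges at \<open>ln 2\<close>,
  and its sum there is the value \<open>1\<close> that removes the singularity.
\<close>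

lemma regularised_series_complex:
  obtains F :: "complex fps"
  where "F * (2 - fps_exp 1) = fps_exp 1 * (fps_const (of_real (ln 2)) - fps_X)"
    and "(\<lambda>n. fps_nth F n * of_real (ln 2) ^ n) sums 1"
proof -
  define c :: complex where "c = of_real (ln 2)"
  have "exp c = of_real (exp (ln 2))" unfolding c_def by (rule exp_of_real)
  then have exp_c: "exp c = 2" by simp
  define g where "g z = exp z * (c - z) / (2 - exp z)" for z
  define f where "f z = (if z = c then 1 else g z)" for z
  have nz: "2 - exp z \<noteq> 0" if "z \<in> ball 0 6 - {c}" for z
    using exp_eq_two_imp[of z] that by (auto simp: c_def)
  \<comment> \<open>\<open>(c - z) / (2 - exp z)\<close> is the reciprocal of a difference quotient of \<open>exp\<close> at \<open>c\<close>\<close>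
  have "((\<lambda>z. (exp z - exp c) / (z - c)) \<longlongrightarrow> exp c) (at c)"
    using DERIV_exp[of c] by (simp add: has_field_derivative_iff)
  then have "((\<lambda>z. exp z / ((exp z - exp c) / (z - c))) \<longlongrightarrow> exp c / exp c) (at c)"
    by (intro tendsto_divide) (auto intro!: tendsto_intros)
  then have "g \<midarrow>c\<rightarrow> 1"
  proof (rule Lim_transform_eventually[OF _ eventually_mono[OF eventually_True], THEN tendsto_eq_rhs])
    show "exp z / ((exp z - exp c) / (z - c)) = g z" for z
      by (cases "z = c"; cases "exp z = 2") (auto simp: g_def exp_c divide_simps algebra_simps)
  qed simp
  moreover have "g holomorphic_on ball 0 6 - {c}"
    unfolding g_def using nz by (auto intro!: holomorphic_intros)
  ultimately have holo: "f holomorphic_on ball 0 6"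
    unfolding f_def by (intro removable_singularity) auto
  then have F: "f has_fps_expansion fps_expansion f 0" (is "_ has_fps_expansion ?F")
    by (intro has_fps_expansion_fps_expansion[of "ball 0 6"]) auto
  have "(\<lambda>z. f z * (2 - exp z)) has_fps_expansion ?F * (2 - fps_exp 1)"
    by (intro fps_expansion_intros F)
  also have "(\<lambda>z. f z * (2 - exp z)) has_fps_expansion ?F * (2 - fps_exp 1) \<longleftrightarrow>
      (\<lambda>z. exp z * (c - z)) has_fps_expansion ?F * (2 - fps_exp 1)"
  proof (rule has_fps_expansion_cong)
    have "eventually (\<lambda>z. z \<in> ball 0 6) (nhds (0::complex))"
      by (intro eventually_nhds_in_open) auto
    then show "eventually (\<lambda>z. f z * (2 - exp z) = exp z * (c - z)) (nhds 0)"
      by eventually_elim (use nz in \<open>auto simp: f_def g_def exp_c\<close>)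
  qed simp
  finally have "?F * (2 - fps_exp 1) = fps_exp 1 * (fps_const c - fps_X)"
    by (rule fps_expansion_unique_complex) (intro fps_expansion_intros)
  moreover have "(\<lambda>n. fps_nth ?F n * c ^ n) sums f c"
  proof (rule has_fps_expansion_imp_sums_complex[OF F])
    show "f holomorphic_on eball 0 (ereal 6)" using holo by simp
    have "norm c < 6" using ln_less_self[of "2::real"] ln_ge_zero[of "2::real"]
      unfolding c_def norm_of_real by linarith
    then show "ereal (norm c) < ereal 6" by simp
  qed
  ultimately show thesis
    by (intro that[of ?F]) (simp_all add: c_def f_def)
qed

text \<open>
  The defining identity of the complex series has real coefficients, so it survives taking real
  parts of the unknown coefficients, and over the reals it has only one solution.
\<close>

lemma regularised_series:
  "(\<lambda>n. fps_nth (tree_series * (fps_const (ln 2) - fps_X)) n * ln 2 ^ n) sums 1"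
proof -
  obtain F :: "complex fps"
    where F: "F * (2 - fps_exp 1) = fps_exp 1 * (fps_const (of_real (ln 2)) - fps_X)"
      and sums: "(\<lambda>n. fps_nth F n * of_real (ln 2) ^ n) sums 1"
    by (rule regularised_series_complex)
  define G where "G = Abs_fps (\<lambda>n. Re (fps_nth F n))"
  let ?E = "fps_exp (1::real)"
  have kernel: "fps_nth (2 - fps_exp (1::complex)) n = of_real (fps_nth (2 - ?E) n)"
    and exp: "fps_nth (fps_exp (1::complex)) n = of_real (fps_nth ?E n)"
    and linear: "fps_nth (fps_const (complex_of_real (ln 2)) - fps_X) n =
      of_real (fps_nth (fps_const (ln 2) - fps_X) n)" for n
    by (auto simp: numeral_fps_const)
  have "G * (2 - ?E) = ?E * (fps_const (ln 2) - fps_X)"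
  proof (rule fps_ext)
    fix n
    have "fps_nth (G * (2 - ?E)) n = Re (fps_nth (F * (2 - fps_exp 1)) n)"
      unfolding fps_mult_nth kernel by (simp add: G_def del: fps_sub_nth)
    also have "\<dots> = fps_nth (?E * (fps_const (ln 2) - fps_X)) n"
      unfolding F fps_mult_nth exp linear of_real_mult[symmetric] of_real_sum[symmetric]
      by (rule Re_complex_of_real)
    finally show "fps_nth (G * (2 - ?E)) n = \<dots>" .
  qed
  then have "G = tree_series * (fps_const (ln 2) - fps_X)"
    unfolding tree_series_def using kernel_inverse by algebra
  moreover have "(\<lambda>n. Re (fps_nth F n * of_real (ln 2) ^ n)) sums Re 1"
    using sums by (rule sums_Re)
  ultimately show ?thesis
    by (simp add: G_def fps_eq_iff flip: of_real_power)
qed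

text \<open>
  Multiplication by \<open>ln 2 - x\<close> makes the coefficients, weighted by powers of \<open>ln 2\<close>, telescope: the
  partial sums of the regularised series at \<open>ln 2\<close> are the weighted coefficients of \<open>tree_series\<close>.
\<close>

lemma tree_series_coeff_limit:
  "(\<lambda>n. fps_nth tree_series n * ln 2 ^ Suc n) \<longlonglongrightarrow> 1"
proof -
  let ?G = "tree_series * (fps_const (ln 2) - fps_X)"
  have "(\<Sum>k<Suc n. fps_nth ?G k * ln 2 ^ k) = fps_nth tree_series n * ln 2 ^ Suc n" for n
  proof (induction n)
    case (Suc n)
    have "fps_nth ?G (Suc n) = ln 2 * fps_nth tree_series (Suc n) - fps_nth tree_series n"
      by (simp add: right_diff_distrib mult.commute[of tree_series])
    with Suc show ?case by (simp add: algebra_simps)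
  qed (simp add: right_diff_distrib mult.commute[of tree_series])
  then show ?thesis
    using LIMSEQ_Suc[OF regularised_series[unfolded sums_def]] by simp
qed

section \<open>Growth of the number of descents\<close>

text \<open>
  For fixed \<open>k\<close> the weight tends to \<open>1\<close> and the last factor to \<open>C\<close>; dominated convergence for series
  (Tannery's theorem) allows the limit to be taken inside the sum. Applied with \<open>v\<close> from
  \<open>descent_factor\<close>, this replaces an analysis of the double pole of \<open>descent_series\<close>.
\<close>

lemma cauchy_product_linear_weight:
  fixes c v :: "nat \<Rightarrow> real"
  assumes c: "c \<longlonglongrightarrow> C" and v: "summable (\<lambda>k. \<bar>v k\<bar>)"
  shows "(\<lambda>n. \<Sum>k\<le>n. v k * (real (Suc (n - k)) / real (Suc n)) * c (Suc (n - k)))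
           \<longlonglongrightarrow> suminf v * C"
proof -
  define a where "a k n =
    (if k \<le> n then v k * (real (Suc (n - k)) / real (Suc n)) * c (Suc (n - k)) else 0)" for k n
  from c obtain K where K: "\<And>n. \<bar>c n\<bar> \<le> K"
    using convergent_imp_Bseq[of c] by (auto simp: convergent_def Bseq_def)
  have "(\<lambda>n. suminf (\<lambda>k. a k n)) \<longlonglongrightarrow> suminf (\<lambda>k. v k * C)"
  proof (rule tannerys_theorem[THEN conjunct2, THEN conjunct2])
    show "a k \<longlonglongrightarrow> v k * C" for k
    proof -
      have "(\<lambda>n. v k * (real (Suc n) / real (Suc (n + k))) * c (Suc n)) \<longlonglongrightarrow> v k * 1 * C"
        by (intro tendsto_mult tendsto_const LIMSEQ_Suc[OF c]) real_asymp
      then have "(\<lambda>n. a k (n + k)) \<longlonglongrightarrow> v k * C" by (simp add: a_def)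
      then show ?thesis by (rule LIMSEQ_offset)
    qed
    have "norm (a k n) \<le> \<bar>v k\<bar> * K" for k n
    proof (cases "k \<le> n")
      case True
      have "\<bar>v k\<bar> * (real (Suc (n - k)) / real (Suc n)) * \<bar>c (Suc (n - k))\<bar> \<le> \<bar>v k\<bar> * 1 * K"
        using K by (intro mult_mono) auto
      then show ?thesis using True by (simp add: a_def abs_mult)
    next
      case False
      have "0 \<le> K" using K[of 0] by linarith
      then show ?thesis using False by (simp add: a_def)
    qed
    then show "eventually (\<lambda>(k, n). norm (a k n) \<le> \<bar>v k\<bar> * K) (at_top \<times>\<^sub>F sequentially)"
      by (intro always_eventually) auto
    show "summable (\<lambda>k. \<bar>v k\<bar> * K)" using v by (rule summable_mult2)
  qed simp
  moreover have "suminf (\<lambda>k. a k n) =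
      (\<Sum>k\<le>n. v k * (real (Suc (n - k)) / real (Suc n)) * c (Suc (n - k)))" for n
    by (subst suminf_finite[of "{..n}"]) (auto simp: a_def)
  moreover have "suminf (\<lambda>k. v k * C) = suminf v * C"
    using v by (intro suminf_mult2[symmetric]) (rule summable_rabs_cancel)
  ultimately show ?thesis by simp
qed

lemma descent_factor_sums:
  "(\<lambda>n. fps_nth descent_factor n * x ^ n) sums (exp x ^ 2 / 2 - 2 * exp x + x + 3/2)"
  and descent_factor_abs_summable: "summable (\<lambda>n. \<bar>fps_nth descent_factor n * x ^ n\<bar>)"
proof -
  have e: "(\<lambda>n. (a * x) ^ n / fact n) sums exp (a * x)"
    and ea: "summable (\<lambda>n. \<bar>(a * x) ^ n / fact n\<bar>)" for a :: real
    using exp_converges[of "a * x"] summable_norm_exp[of "a * x"]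
    by (simp_all add: divide_inverse mult.commute)
  let ?p = "\<lambda>n. if n = 0 then 3/2 else if n = 1 then x else 0"
  have p: "?p sums (x + 3/2)" and pa: "summable (\<lambda>n. \<bar>?p n\<bar>)"
    using sums_finite[of "{0, 1}" ?p] summable_finite[of "{0, 1}" "\<lambda>n. \<bar>?p n\<bar>"]
    by (auto simp: add.commute)
  have nth: "fps_nth descent_factor n * x ^ n =
      1/2 * ((2 * x) ^ n / fact n) - 2 * ((1 * x) ^ n / fact n) + ?p n" for n
    unfolding descent_factor_def fps_exp_power_mult
    by (simp add: numeral_fps_const fps_X_def power_mult_distrib algebra_simps)
  have "(\<lambda>n. 1/2 * ((2 * x) ^ n / fact n) - 2 * ((1 * x) ^ n / fact n) + ?p n) sums
      (1/2 * exp (2 * x) - 2 * exp (1 * x) + (x + 3/2))"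
    by (intro sums_add sums_diff sums_mult e p)
  then show "(\<lambda>n. fps_nth descent_factor n * x ^ n) sums (exp x ^ 2 / 2 - 2 * exp x + x + 3/2)"
    unfolding nth by (simp add: exp_double add.assoc)
  show "summable (\<lambda>n. \<bar>fps_nth descent_factor n * x ^ n\<bar>)"
  proof (rule summable_comparison_test)
    show "summable (\<lambda>n. 1/2 * \<bar>(2 * x) ^ n / fact n\<bar> + 2 * \<bar>(1 * x) ^ n / fact n\<bar> + \<bar>?p n\<bar>)"
      by (intro summable_add summable_mult ea pa)
    show "\<exists>N. \<forall>n\<ge>N. norm \<bar>fps_nth descent_factor n * x ^ n\<bar> \<le>
        1/2 * \<bar>(2 * x) ^ n / fact n\<bar> + 2 * \<bar>(1 * x) ^ n / fact n\<bar> + \<bar>?p n\<bar>"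
      unfolding nth by (intro exI allI impI) (simp only: abs_if real_norm_def, argo)
  qed
qed

text \<open>
  \<open>descent_series\<close> is the derivative of \<open>tree_series\<close> times an entire factor. Asymptotically, its
  coefficients are those of the derivative, scaled by the value \<open>ln 2 - 1/2\<close> of that factor at the
  singularity \<open>ln 2\<close>.
\<close>

lemma descent_series_coeff_limit:
  "(\<lambda>n. fps_nth descent_series n * ln 2 ^ (n + 2) / real (Suc n)) \<longlonglongrightarrow> ln 2 - 1/2"
proof -
  let ?v = "\<lambda>k. fps_nth descent_factor k * ln 2 ^ k"
  let ?c = "\<lambda>n. fps_nth tree_series n * ln 2 ^ Suc n"
  have "(\<lambda>n. \<Sum>k\<le>n. ?v k * (real (Suc (n - k)) / real (Suc n)) * ?c (Suc (n - k)))
      \<longlonglongrightarrow> suminf ?v * 1"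
    by (intro cauchy_product_linear_weight tree_series_coeff_limit descent_factor_abs_summable)
  also have "suminf ?v = ln 2 - 1/2"
    using descent_factor_sums[of "ln 2"] by (simp add: sums_iff)
  also have "(\<lambda>n. \<Sum>k\<le>n. ?v k * (real (Suc (n - k)) / real (Suc n)) * ?c (Suc (n - k))) =
      (\<lambda>n. fps_nth descent_series n * ln 2 ^ (n + 2) / real (Suc n))"
  proof
    fix n
    have "fps_nth descent_series n =
        (\<Sum>k\<le>n. fps_nth descent_factor k * (real (Suc (n - k)) * fps_nth tree_series (Suc (n - k))))"
      unfolding descent_series_def mult.commute[of _ descent_factor]
      by (simp add: fps_mult_nth atLeast0AtMost)
    then have "fps_nth descent_series n * ln 2 ^ (n + 2) / real (Suc n) =
        (\<Sum>k\<le>n. fps_nth descent_factor k * (real (Suc (n - k)) * fps_nth tree_series (Suc (n - k)))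
          * ln 2 ^ (n + 2) / real (Suc n))"
      by (simp only: sum_distrib_right sum_divide_distrib)
    also have "\<dots> = (\<Sum>k\<le>n. ?v k * (real (Suc (n - k)) / real (Suc n)) * ?c (Suc (n - k)))"
    proof (intro sum.cong refl)
      fix k assume "k \<in> {..n}"
      then have "(ln 2 :: real) ^ (n + 2) = ln 2 ^ k * ln 2 ^ Suc (Suc (n - k))"
        by (simp flip: power_add)
      then show "fps_nth descent_factor k * (real (Suc (n - k)) * fps_nth tree_series (Suc (n - k)))
          * ln 2 ^ (n + 2) / real (Suc n) =
        ?v k * (real (Suc (n - k)) / real (Suc n)) * ?c (Suc (n - k))"
        by (simp only:) (simp add: mult_ac)
    qed
    finally show "(\<Sum>k\<le>n. ?v k * (real (Suc (n - k)) / real (Suc n)) * ?c (Suc (n - k))) =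
        fps_nth descent_series n * ln 2 ^ (n + 2) / real (Suc n)" ..
  qed
  finally show ?thesis by simp
qed

lemma expectation_des:
  "measure_pmf.expectation (pmf_of_set (DSch m)) (\<lambda>T. real (des (postorder_reading T) + 1)) =
     fps_nth descent_series m / fps_nth tree_series m + 1"
proof -
  have card: "real (card (DSch m)) = fact m * fps_nth tree_series m"
    using card_labelled_trees[of "{1..m}"] by (simp add: DSch_eq_labelled_trees egf_def)
  have "(\<Sum>T\<in>DSch m. real (des (postorder_reading T))) = fact m * fps_nth descent_series m"
    using sum_des_labelled_trees[of "{1..m}"] by (simp add: DSch_eq_labelled_trees egf_def)
  then have "(\<Sum>T\<in>DSch m. real (des (postorder_reading T) + 1)) =
      fact m * fps_nth descent_series m + fact m * fps_nth tree_series m"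
    by (simp add: sum.distrib card)
  moreover have "card (DSch m) \<noteq> 0" using finite_DSch DSch_nonempty by simp
  then have "fps_nth tree_series m \<noteq> 0" using card by auto
  ultimately show ?thesis
    by (simp add: integral_pmf_of_set finite_DSch DSch_nonempty card add_divide_distrib)
qed

theorem theorem7p25:
  shows "(\<lambda>n::nat. measure_pmf.expectation (pmf_of_set (DSch (n - 1)))
                     (\<lambda>T. real (des (postorder_reading T) + 1)))
         \<sim>[at_top] (\<lambda>n. (1 - 1 / (2 * ln 2)) * real n)"
proof -
  let ?a = "fps_nth tree_series" and ?d = "fps_nth descent_series"
  let ?e = "\<lambda>m. ?d m / ?a m + 1"
  \<comment> \<open>one factor \<open>ln 2\<close> is left over because the derivative shifts the coefficients by one\<close>
  have "(\<lambda>m. (?d m * ln 2 ^ (m + 2) / real (Suc m)) / (?a m * ln 2 ^ Suc m) / ln 2 + 1 / real (Suc m))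
      \<longlonglongrightarrow> (ln 2 - 1/2) / 1 / ln 2 + 0"
    by (intro tendsto_add tendsto_divide descent_series_coeff_limit tree_series_coeff_limit
        tendsto_const) (auto, real_asymp)
  also have "(\<lambda>m. (?d m * ln 2 ^ (m + 2) / real (Suc m)) / (?a m * ln 2 ^ Suc m) / ln 2 + 1 / real (Suc m))
      = (\<lambda>m. ?e m / real (Suc m))"
    by (auto simp: fun_eq_iff add_divide_distrib power_Suc)
  also have "(ln 2 - 1/2) / 1 / ln 2 + 0 = 1 - 1 / (2 * ln (2::real))"
    by (simp add: field_simps)
  finally have lim: "(\<lambda>m. ?e m / real (Suc m)) \<longlonglongrightarrow> 1 - 1 / (2 * ln 2)" .
  have "ln (2::real) > 1/2" using ln2_ge_two_thirds by simp
  then have nz: "1 - 1 / (2 * ln (2::real)) \<noteq> 0" by (simp add: field_simps)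
  have "(\<lambda>m. ?e m / real (Suc m) / (1 - 1 / (2 * ln 2)))
      \<longlonglongrightarrow> (1 - 1 / (2 * ln 2)) / (1 - 1 / (2 * ln 2))"
    by (intro tendsto_divide lim tendsto_const nz)
  then have "(\<lambda>m. ?e (Suc m - 1) / ((1 - 1 / (2 * ln 2)) * real (Suc m))) \<longlonglongrightarrow> 1"
    using nz by (simp add: mult.commute)
  then have "(\<lambda>n. ?e (n - 1) / ((1 - 1 / (2 * ln 2)) * real n)) \<longlonglongrightarrow> 1"
    by (rule LIMSEQ_imp_Suc)
  then show ?thesis
    unfolding expectation_des by (rule asymp_equivI')
qed

end
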